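(* There exists an oriented graph $H$ which is Tur\'anable but which is not a subgraph of $D_s$ for any $s \in \mathbb{N}$.
   Context: An oriented graph is a directed graph with no loops in which, for every pair of distinct vertices $u,v$, at most one of the ordered edges $uv$, $vu$ is present; a tournament is an oriented graph in which exactly one of them is present for every pair. For a vertex $v$, $d^+(v)$ and $d^-(v)$ are its out- and in-degree, and the minimum semi-degree $\delta^0(G)$ is the minimum over all vertices of all in- and out-degrees. A regular tournament is a tournament on an odd number $n$ of vertices with $\delta^0 = (n-1)/2$. An oriented graph $H$ is Tur\'anable if there exists $n_0$ such that every regular tournament on $n \ge n_0$ vertices contains a copy of $H$ (as a subgraph). For integers $s \ge 1$, $D_s$ is the tournament on $3s$ vertices with vertex set partitioned into three sets $A,B,C$ of size $s$, each inducing a transitive tournament, with all edges between distinct parts oriented from $A$ to $B$, from $B$ to $C$, and from $C$ to $A$. *)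

theory Defs
  imports "Graph_Theory.Graph_Theory"
begin

locale oriented_graph = pair_digraph G for G :: "'a pair_pre_digraph" +
  assumes not_both_directions:
    "\<lbrakk>u \<in> pverts G; v \<in> pverts G; u \<noteq> v\<rbrakk> \<Longrightarrow> \<not> ((u, v) \<in> parcs G \<and> (v, u) \<in> parcs G)"

locale tournament = oriented_graph G for G :: "'a pair_pre_digraph" +
  assumes exactly_one_direction:
    "\<lbrakk>u \<in> pverts G; v \<in> pverts G; u \<noteq> v\<rbrakk> \<Longrightarrow> (u, v) \<in> parcs G \<longleftrightarrow> (v, u) \<notin> parcs G"

definition min_semi_degree :: "'a pair_pre_digraph \<Rightarrow> nat" where
  "min_semi_degree G =
     Min (in_degree (with_proj G) ` pverts G \<union> out_degree (with_proj G) ` pverts G)"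

definition regular_tournament :: "'a pair_pre_digraph \<Rightarrow> bool" where
  "regular_tournament G \<longleftrightarrow>
     tournament G \<and> odd (card (pverts G)) \<and> min_semi_degree G = (card (pverts G) - 1) div 2"

text \<open>The subgraph need not be induced.\<close>

definition contains_copy :: "'a pair_pre_digraph \<Rightarrow> 'b pair_pre_digraph \<Rightarrow> bool" where
  "contains_copy G H \<longleftrightarrow> (\<exists>K. subgraph K (with_proj G) \<and> digraph_iso (with_proj H) K)"

text \<open>
  HOL cannot quantify over types inside a definition, so the host tournaments range over all finite
  sets of natural numbers. Every finite graph is isomorphic to one of this kind;
  \<open>turanable_any_type\<close> below shows that nothing is lost.
\<close>

definition turanable :: "'a pair_pre_digraph \<Rightarrow> bool" where
  "turanable H \<longleftrightarrow>
     (\<exists>n\<^sub>0. \<forall>G :: nat pair_pre_digraph.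
        regular_tournament G \<and> card (pverts G) \<ge> n\<^sub>0 \<longrightarrow> contains_copy G H)"

text \<open>
  The vertex \<open>(i, a)\<close> is the \<open>a\<close>-th vertex of the part \<open>A\<close>, \<open>B\<close>, \<open>C\<close> for \<open>i = 0, 1, 2\<close>
  respectively, in the transitive order of that part.
\<close>

definition D_tournament :: "nat \<Rightarrow> (nat \<times> nat) pair_pre_digraph" where
  "D_tournament s =
     \<lparr>pverts = {..<3} \<times> {..<s},
      parcs = {((i, a), (j, b)) | i a j b.
                 i < 3 \<and> j < 3 \<and> a < s \<and> b < s \<and>
                 (i = j \<and> a < b \<or> (i, j) \<in> {(0, 1), (1, 2), (2, 0)})}\<rparr>"

lemma contains_copy_iff:
  assumes "pair_wf_digraph G" "pair_wf_digraph H"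
  shows "contains_copy G H \<longleftrightarrow>
    (\<exists>f. inj_on f (pverts H) \<and> f ` pverts H \<subseteq> pverts G \<and>
         (\<forall>(u, v) \<in> parcs H. (f u, f v) \<in> parcs G))"
proof
  assume "contains_copy G H"
  then obtain h where sub: "subgraph (app_iso h (with_proj H)) (with_proj G)"
    and iso: "pre_digraph.digraph_isomorphism (with_proj H) h"
    unfolding contains_copy_def digraph_iso_def by blast
  from sub have ht: "iso_tail h = fst" "iso_head h = snd"
    by (auto simp: subgraph_def compatible_def)
  have "(iso_verts h u, iso_verts h v) \<in> parcs G" if uv: "(u, v) \<in> parcs H" for u v
  proof -
    have "fst (iso_arcs h (u, v)) = iso_verts h u" "snd (iso_arcs h (u, v)) = iso_verts h v"
      using iso uv ht unfolding pre_digraph.digraph_isomorphism_def by fastforce+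
    then have "iso_arcs h (u, v) = (iso_verts h u, iso_verts h v)" by (simp add: prod_eq_iff)
    moreover have "iso_arcs h (u, v) \<in> parcs G"
      using sub uv by (auto simp: subgraph_def)
    ultimately show ?thesis by simp
  qed
  moreover have "inj_on (iso_verts h) (pverts H)"
    using iso by (simp add: pre_digraph.digraph_isomorphism_def)
  moreover have "iso_verts h ` pverts H \<subseteq> pverts G"
    using sub by (simp add: subgraph_def)
  ultimately show "\<exists>f. inj_on f (pverts H) \<and> f ` pverts H \<subseteq> pverts G \<and>
         (\<forall>(u, v) \<in> parcs H. (f u, f v) \<in> parcs G)"
    by blast
next
  assume "\<exists>f. inj_on f (pverts H) \<and> f ` pverts H \<subseteq> pverts G \<and>
         (\<forall>(u, v) \<in> parcs H. (f u, f v) \<in> parcs G)"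
  then obtain f where f: "inj_on f (pverts H)" "f ` pverts H \<subseteq> pverts G"
    "\<forall>(u, v) \<in> parcs H. (f u, f v) \<in> parcs G" by blast
  define h where "h = \<lparr>iso_verts = f, iso_arcs = map_prod f f, iso_head = snd, iso_tail = fst\<rparr>"
  have wf: "wf_digraph (with_proj H)" "wf_digraph (with_proj G)"
    using assms by (simp_all add: wf_digraph_wp_iff)
  have sub: "parcs H \<subseteq> pverts H \<times> pverts H"
    using assms(2) by (meson mem_Sigma_iff pair_wf_digraph.in_arcsD1 pair_wf_digraph.in_arcsD2 subrelI)
  have inj: "inj_on (map_prod f f) (parcs H)"
    by (rule inj_on_subset[OF map_prod_inj_on[OF f(1) f(1)] sub])
  have iso: "pre_digraph.digraph_isomorphism (with_proj H) h"
    unfolding pre_digraph.digraph_isomorphism_def using wf f inj by (auto simp: h_def)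
  then have "wf_digraph (app_iso h (with_proj H))"
    using wf_digraph.wf_digraphI_app_iso[OF wf(1)] by blast
  then have "subgraph (app_iso h (with_proj H)) (with_proj G)"
    using wf f by (auto simp: subgraph_def compatible_def h_def)
  then show "contains_copy G H"
    unfolding contains_copy_def digraph_iso_def using iso by blast
qed

lemma tournament_D_tournament: "tournament (D_tournament s)"
proof
  show fin: "finite (pverts (D_tournament s))" by (simp add: D_tournament_def)
  have sub: "parcs (D_tournament s) \<subseteq> pverts (D_tournament s) \<times> pverts (D_tournament s)"
    unfolding D_tournament_def by auto
  then show "finite (parcs (D_tournament s))"
    using fin finite_subset by blast
  fix e assume e: "e \<in> parcs (D_tournament s)"
  show "fst e \<in> pverts (D_tournament s)" "snd e \<in> pverts (D_tournament s)"
    using e sub by auto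
  show "fst e \<noteq> snd e"
    using e unfolding D_tournament_def by auto
next
  fix u v assume uv: "u \<in> pverts (D_tournament s)" "v \<in> pverts (D_tournament s)" "u \<noteq> v"
  obtain i a j b where ij: "u = (i, a)" "v = (j, b)" by (metis prod.collapse)
  have bd: "i < 3" "j < 3" "a < s" "b < s" using uv ij by (auto simp: D_tournament_def)
  have uv_arc: "(u, v) \<in> parcs (D_tournament s) \<longleftrightarrow>
      i = j \<and> a < b \<or> i = 0 \<and> j = 1 \<or> i = 1 \<and> j = 2 \<or> i = 2 \<and> j = 0"
    and vu_arc: "(v, u) \<in> parcs (D_tournament s) \<longleftrightarrow>
      j = i \<and> b < a \<or> j = 0 \<and> i = 1 \<or> j = 1 \<and> i = 2 \<or> j = 2 \<and> i = 0"
    unfolding D_tournament_def ij using bd by simp_all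
  have ne: "i \<noteq> j \<or> a \<noteq> b" using uv(3) ij by simp
  show "\<not> ((u, v) \<in> parcs (D_tournament s) \<and> (v, u) \<in> parcs (D_tournament s))"
    "(u, v) \<in> parcs (D_tournament s) \<longleftrightarrow> (v, u) \<notin> parcs (D_tournament s)"
    unfolding uv_arc vu_arc using bd ne by presburger+
qed

lemma turanable_any_type:
  assumes H: "pair_wf_digraph H" and "turanable H"
  shows "\<exists>n\<^sub>0. \<forall>G :: 'b pair_pre_digraph.
    regular_tournament G \<and> card (pverts G) \<ge> n\<^sub>0 \<longrightarrow> contains_copy G H"
proof -
  obtain n\<^sub>0 where n0: "\<And>G :: nat pair_pre_digraph.
      regular_tournament G \<Longrightarrow> card (pverts G) \<ge> n\<^sub>0 \<Longrightarrow> contains_copy G H"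
    using assms unfolding turanable_def by blast
  have "contains_copy G H"
    if reg: "regular_tournament G" and n: "card (pverts G) \<ge> n\<^sub>0" for G :: "'b pair_pre_digraph"
  proof -
    interpret tournament G using reg by (simp add: regular_tournament_def)
    obtain g :: "'b \<Rightarrow> nat" where g: "inj_on g (pverts G)"
      using finite_imp_inj_to_nat_seg[OF pair_finite_verts] by blast
    define G' where "G' = \<lparr>pverts = g ` pverts G, parcs = map_prod g g ` parcs G\<rparr>"
    have sub: "parcs G \<subseteq> pverts G \<times> pverts G"
      using in_arcsD1 in_arcsD2 by (meson mem_Sigma_iff subrelI)
    have arc: "(g u, g v) \<in> parcs G' \<longleftrightarrow> (u, v) \<in> parcs G"
      if "u \<in> pverts G" "v \<in> pverts G" for u v
    proof
      assume "(g u, g v) \<in> parcs G'"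
      then obtain x y where xy: "(x, y) \<in> parcs G" "g u = g x" "g v = g y"
        by (auto simp: G'_def)
      then have "u = x" "v = y"
        using g that in_arcsD1 in_arcsD2 by (metis inj_onD)+
      then show "(u, v) \<in> parcs G" using xy by simp
    next
      assume "(u, v) \<in> parcs G"
      then show "(g u, g v) \<in> parcs G'" by (force simp: G'_def)
    qed
    have wf: "parcs G' \<subseteq> pverts G' \<times> pverts G'"
      using sub by (auto simp: G'_def)
    have injp: "inj_on (map_prod g g) (parcs G)"
      by (rule inj_on_subset[OF map_prod_inj_on[OF g g] sub])
    have V: "pverts G' = g ` pverts G" by (simp add: G'_def)
    have T: "tournament G'"
    proof unfold_locales
      fix e assume e: "e \<in> parcs G'"
      show "fst e \<in> pverts G'" "snd e \<in> pverts G'" using e wf by auto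
      obtain x y where xy: "(x, y) \<in> parcs G" "e = (g x, g y)"
        using e by (auto simp: G'_def)
      then show "fst e \<noteq> snd e"
        using g pair_no_loops[of "(x, y)"] in_arcsD1 in_arcsD2 by (simp add: inj_on_eq_iff)
    next
      show "finite (pverts G')" "finite (parcs G')"
        by (simp_all add: G'_def pair_finite_verts pair_finite_arcs)
    next
      fix u v assume "u \<in> pverts G'" "v \<in> pverts G'" "u \<noteq> v"
      then obtain x y where "u = g x" "v = g y" "x \<in> pverts G" "y \<in> pverts G" "x \<noteq> y"
        unfolding V by auto
      then show "\<not> ((u, v) \<in> parcs G' \<and> (v, u) \<in> parcs G')"
        "(u, v) \<in> parcs G' \<longleftrightarrow> (v, u) \<notin> parcs G'"
        using arc[of x y] arc[of y x] exactly_one_direction[of x y] by simp_all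
    qed
    have deg: "in_degree (with_proj G') (g v) = in_degree (with_proj G) v"
      "out_degree (with_proj G') (g v) = out_degree (with_proj G) v" if v: "v \<in> pverts G" for v
    proof -
      have eq: "g x = g v \<longleftrightarrow> x = v" if "x \<in> pverts G" for x
        using g v that by (simp add: inj_on_eq_iff)
      have "in_arcs (with_proj G') (g v) = map_prod g g ` {e \<in> parcs G. g (snd e) = g v}"
        "out_arcs (with_proj G') (g v) = map_prod g g ` {e \<in> parcs G. g (fst e) = g v}"
        unfolding in_arcs_def out_arcs_def by (auto simp: G'_def)
      moreover have "{e \<in> parcs G. g (snd e) = g v} = in_arcs (with_proj G) v"
        "{e \<in> parcs G. g (fst e) = g v} = out_arcs (with_proj G) v"
        unfolding in_arcs_def out_arcs_def by (auto simp: eq[OF in_arcsD1] eq[OF in_arcsD2])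
      ultimately have "in_arcs (with_proj G') (g v) = map_prod g g ` in_arcs (with_proj G) v"
        "out_arcs (with_proj G') (g v) = map_prod g g ` out_arcs (with_proj G) v"
        by simp_all
      moreover have "inj_on (map_prod g g) (in_arcs (with_proj G) v)"
        "inj_on (map_prod g g) (out_arcs (with_proj G) v)"
        by (rule inj_on_subset[OF injp]; auto)+
      ultimately show "in_degree (with_proj G') (g v) = in_degree (with_proj G) v"
        "out_degree (with_proj G') (g v) = out_degree (with_proj G) v"
        by (simp_all add: in_degree_def out_degree_def card_image)
    qed
    have "min_semi_degree G' = min_semi_degree G"
      unfolding min_semi_degree_def V image_image using deg by simp
    moreover have card: "card (pverts G') = card (pverts G)"
      using g by (simp add: V card_image)
    ultimately have "regular_tournament G'"
      using reg T by (simp add: regular_tournament_def)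
    then have "contains_copy G' H" using n0 n card by simp
    moreover have "pair_wf_digraph G'"
      using wf by unfold_locales auto
    ultimately obtain f where f: "inj_on f (pverts H)" "f ` pverts H \<subseteq> pverts G'"
      "\<forall>(u, v) \<in> parcs H. (f u, f v) \<in> parcs G'"
      using H contains_copy_iff by blast
    define k where "k = the_inv_into (pverts G) g \<circ> f"
    have k: "k u \<in> pverts G" "g (k u) = f u" if "u \<in> pverts H" for u
      using that f(2) g unfolding V k_def comp_def
      by (auto simp: f_the_inv_into_f image_subset_iff intro!: the_inv_into_into)
    have "inj_on k (pverts H)"
      using f(1) k(2) by (metis inj_on_def)
    moreover have "(k u, k v) \<in> parcs G" if "(u, v) \<in> parcs H" for u v
    proof -
      have "u \<in> pverts H" "v \<in> pverts H"
        using pair_wf_digraph.in_arcsD1[OF H that] pair_wf_digraph.in_arcsD2[OF H that] by auto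
      then show ?thesis using arc[of "k u" "k v"] k f(3) that by auto
    qed
    ultimately show ?thesis
      using k(1) by (subst contains_copy_iff[OF pair_wf_digraph H]) blast
  qed
  then show ?thesis by blast
qed

end

theory Submission
  imports Defs
begin

text \<open>
  The witness is two cyclic triangles \<open>1 \<rightarrow> 2 \<rightarrow> 4 \<rightarrow> 1\<close> and \<open>2 \<rightarrow> 3 \<rightarrow> 5 \<rightarrow> 2\<close> sharing a vertex, together
  with a vertex \<open>0\<close> dominating \<open>1, 2, 3\<close>. A cyclic triangle of \<open>D\<^sub>s\<close> runs through the three parts in
  cyclic order, so in a copy inside \<open>D\<^sub>s\<close> the vertices \<open>1, 2, 3\<close> would lie in three different parts,
  whereas the out-neighbours of a vertex of \<open>D\<^sub>s\<close> meet only two parts. In a regular tournament, on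
  the other hand, every arc lies in a cyclic triangle, so it suffices to take a transitive triangle
  inside some out-neighbourhood and complete two of its arcs to cyclic triangles.
\<close>

definition dominated_bowtie :: "nat pair_pre_digraph" where
  "dominated_bowtie =
     \<lparr>pverts = {0, 1, 2, 3, 4, 5},
      parcs = {(0, 1), (0, 2), (0, 3), (1, 2), (2, 4), (4, 1), (2, 3), (3, 5), (5, 2)}\<rparr>"

lemma oriented_graph_dominated_bowtie: "oriented_graph dominated_bowtie"
proof unfold_locales
  fix u v
  show "\<not> ((u, v) \<in> parcs dominated_bowtie \<and> (v, u) \<in> parcs dominated_bowtie)"
  proof (rule notI, elim conjE)
    assume "(u, v) \<in> parcs dominated_bowtie" "(v, u) \<in> parcs dominated_bowtie"
    then show False
      by (simp only: dominated_bowtie_def pair_pre_digraph.simps insert_iff empty_iff prod.inject)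
        (elim disjE conjE; simp)
  qed
qed (auto simp: dominated_bowtie_def)

lemma pair_wf_digraph_dominated_bowtie: "pair_wf_digraph dominated_bowtie"
proof -
  interpret oriented_graph dominated_bowtie by (rule oriented_graph_dominated_bowtie)
  show ?thesis by (rule pair_wf_digraph)
qed

lemma contains_copy_dominated_bowtieI:
  assumes "pair_wf_digraph G" and dist: "distinct [a, b, c, d, e, f]"
    and arcs: "{(a, b), (a, c), (a, d), (b, c), (c, e), (e, b), (c, d), (d, f), (f, c)} \<subseteq> parcs G"
  shows "contains_copy G dominated_bowtie"
proof -
  define g where "g = nth [a, b, c, d, e, f]"
  \<comment> \<open>The value at \<open>1\<close> is listed twice because the simplifier may rewrite
    \<open>1\<close> to \<open>Suc 0\<close>.\<close>
  have g: "g 0 = a" "g 1 = b" "g (Suc 0) = b" "g 2 = c" "g 3 = d" "g 4 = e" "g 5 = f"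
    by (simp_all add: g_def)
  have "inj_on g (pverts dominated_bowtie)"
    using dist by (auto simp: dominated_bowtie_def g)
  moreover have "g ` pverts dominated_bowtie \<subseteq> pverts G"
    using arcs pair_wf_digraph.in_arcsD1[OF assms(1)] pair_wf_digraph.in_arcsD2[OF assms(1)]
    by (simp add: dominated_bowtie_def g) blast
  moreover have "\<forall>(u, v) \<in> parcs dominated_bowtie. (g u, g v) \<in> parcs G"
    using arcs by (simp add: dominated_bowtie_def g)
  ultimately show ?thesis
    using contains_copy_iff[OF assms(1) pair_wf_digraph_dominated_bowtie] by blast
qed

lemma arc_D_tournament:
  assumes "(u, v) \<in> parcs (D_tournament s)"
  shows "fst v = fst u \<or> (fst u, fst v) \<in> {(0, 1), (1, 2), (2, 0)}"
  using assms by (auto simp: D_tournament_def)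

text \<open>Each arc stays in its part or advances one part cyclically, so a closed walk of three
  arcs advances three times or never. The latter would put a cycle inside a transitive part.\<close>

lemma cyclic_triangle_D_tournament:
  assumes "(u, v) \<in> parcs (D_tournament s)" "(v, w) \<in> parcs (D_tournament s)"
    "(w, u) \<in> parcs (D_tournament s)"
  shows "(fst u, fst v) \<in> {(0, 1), (1, 2), (2, 0)}"
  using assms by (cases u; cases v; cases w) (auto simp: D_tournament_def)

lemma not_contains_copy_D_tournament_dominated_bowtie:
  "\<not> contains_copy (D_tournament s) dominated_bowtie"
proof
  interpret tournament "D_tournament s" by (rule tournament_D_tournament)
  assume "contains_copy (D_tournament s) dominated_bowtie"
  then obtain g where "\<forall>(u, v) \<in> parcs dominated_bowtie. (g u, g v) \<in> parcs (D_tournament s)"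
    using contains_copy_iff[OF pair_wf_digraph pair_wf_digraph_dominated_bowtie] by blast
  then have arcs: "(g 0, g 1) \<in> parcs (D_tournament s)" "(g 0, g 2) \<in> parcs (D_tournament s)"
    "(g 0, g 3) \<in> parcs (D_tournament s)"
    and cyc: "(fst (g 1), fst (g 2)) \<in> {(0, 1), (1, 2), (2, 0)}"
      "(fst (g 2), fst (g 3)) \<in> {(0, 1), (1, 2), (2, 0)}"
    using cyclic_triangle_D_tournament[of "g 1" "g 2" s "g 4"]
      cyclic_triangle_D_tournament[of "g 2" "g 3" s "g 5"]
    by (simp_all add: dominated_bowtie_def)
  \<comment> \<open>By \<open>cyc\<close>, one of \<open>g 1\<close>, \<open>g 2\<close>,
    \<open>g 3\<close> lies in the part cyclically preceding that of \<open>g 0\<close>, and no arc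
    leads from \<open>g 0\<close> into that part.\<close>
  show False
    using arcs[THEN arc_D_tournament] cyc by auto
qed

text \<open>Library degrees count arcs, while the later arguments compare neighbourhoods; arcs are
  pairs, so those at \<open>v\<close> correspond to its neighbours.\<close>

lemma regular_tournament_min_degree:
  assumes "regular_tournament G" "v \<in> pverts G"
  shows "card {x. (v, x) \<in> parcs G} \<ge> (card (pverts G) - 1) div 2"
    "card {x. (x, v) \<in> parcs G} \<ge> (card (pverts G) - 1) div 2"
proof -
  interpret tournament G using assms(1) by (simp add: regular_tournament_def)
  have "min_semi_degree G \<le> out_degree (with_proj G) v" "min_semi_degree G \<le> in_degree (with_proj G) v"
    unfolding min_semi_degree_def using assms(2) pair_finite_verts by (auto intro!: Min_le)
  moreover have "out_arcs (with_proj G) v = Pair v ` {x. (v, x) \<in> parcs G}"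
    "in_arcs (with_proj G) v = (\<lambda>x. (x, v)) ` {x. (x, v) \<in> parcs G}"
    by (auto simp: out_arcs_def in_arcs_def)
  then have "out_degree (with_proj G) v = card {x. (v, x) \<in> parcs G}"
    "in_degree (with_proj G) v = card {x. (x, v) \<in> parcs G}"
    by (simp_all add: out_degree_def in_degree_def card_image inj_on_def)
  ultimately show "card {x. (v, x) \<in> parcs G} \<ge> (card (pverts G) - 1) div 2"
    "card {x. (x, v) \<in> parcs G} \<ge> (card (pverts G) - 1) div 2"
    using assms(1) by (simp_all add: regular_tournament_def)
qed

text \<open>If no such \<open>z\<close> existed, \<open>u\<close> would dominate \<open>w\<close>
  and every out-neighbour of \<open>w\<close>, making its out-degree larger than regularity
  allows.\<close>

lemma regular_tournament_arc_in_cyclic_triangle: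
  assumes reg: "regular_tournament G" and uw: "(u, w) \<in> parcs G"
  obtains z where "(w, z) \<in> parcs G" "(z, u) \<in> parcs G"
proof -
  interpret tournament G using reg by (simp add: regular_tournament_def)
  define S P where "S = (\<lambda>v. {x. (v, x) \<in> parcs G})" and "P = (\<lambda>v. {x. (x, v) \<in> parcs G})"
  have V: "u \<in> pverts G" "w \<in> pverts G" using uw in_arcsD1 in_arcsD2 by blast+
  have sub: "S v \<subseteq> pverts G" "P v \<subseteq> pverts G" for v
    unfolding S_def P_def using in_arcsD1 in_arcsD2 by blast+
  then have fin: "finite (S v)" "finite (P v)" for v
    by (simp_all add: finite_subset[OF _ pair_finite_verts])
  have loop: "(v, v) \<notin> parcs G" for v using pair_no_loops by fastforce
  have asym: "(y, x) \<notin> parcs G" if "(x, y) \<in> parcs G" for x y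
    using not_both_directions[OF in_arcsD1[OF that] in_arcsD2[OF that]] that loop by blast
  have "\<exists>z. (w, z) \<in> parcs G \<and> (z, u) \<in> parcs G"
  proof (rule ccontr)
    assume no: "\<nexists>z. (w, z) \<in> parcs G \<and> (z, u) \<in> parcs G"
    have "insert w (S w) \<subseteq> S u"
    proof
      fix z assume "z \<in> insert w (S w)"
      moreover have "(u, z) \<in> parcs G" if wz: "(w, z) \<in> parcs G"
      proof -
        \<comment> \<open>Totality applies only to distinct vertices; since \<open>no\<close>
          forbids the arc from \<open>z\<close> to \<open>u\<close>, the reverse arc is
          present.\<close>
        have "z \<noteq> u" using wz uw asym by blast
        then show ?thesis using wz no V in_arcsD2 exactly_one_direction by blast
      qed
      ultimately show "z \<in> S u" using uw by (auto simp: S_def)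
    qed
    then have "card (insert w (S w)) \<le> card (S u)" using fin by (simp add: card_mono)
    then have "card (S w) < card (S u)" using loop fin by (simp add: S_def)
    moreover have "card (S u) + card (P u) < card (pverts G)"
    proof -
      have "S u \<inter> P u = {}" using asym by (auto simp: S_def P_def)
      then have "card (S u \<union> P u) = card (S u) + card (P u)" using fin by (simp add: card_Un_disjoint)
      moreover have "u \<notin> S u \<union> P u" using loop by (simp add: S_def P_def)
      then have "S u \<union> P u \<subset> pverts G" using sub V by blast
      ultimately show ?thesis using psubset_card_mono[OF pair_finite_verts] by metis
    qed
    moreover have "odd (card (pverts G))" using reg by (simp add: regular_tournament_def)
    \<comment> \<open>With 2k + 1 vertices, \<open>u\<close> has at least k + 1 out-neighbours and k
      in-neighbours, which together with \<open>u\<close> is one vertex too many.\<close>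
    ultimately show False
      using regular_tournament_min_degree(1)[OF reg V(2)] regular_tournament_min_degree(2)[OF reg V(1)]
      unfolding S_def P_def by presburger
  qed
  then show thesis using that by blast
qed

text \<open>Among the three or more vertices of \<open>X\<close> other than a chosen
  \<open>a\<close>, two lie on the same side of \<open>a\<close>. The bound 4 is sharp because of
  the cyclic triangle.\<close>

lemma tournament_transitive_triangle:
  assumes T: "tournament G" and X: "X \<subseteq> pverts G" "card X \<ge> 4"
  obtains x y z where "x \<in> X" "y \<in> X" "z \<in> X"
    "(x, y) \<in> parcs G" "(y, z) \<in> parcs G" "(x, z) \<in> parcs G"
proof -
  interpret tournament G by (rule T)
  have total: "(x, y) \<in> parcs G \<or> (y, x) \<in> parcs G" if "x \<in> X" "y \<in> X" "x \<noteq> y" for x y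
    using that X(1) exactly_one_direction by blast
  have fin: "finite X" using X(1) finite_subset pair_finite_verts by blast
  obtain a where a: "a \<in> X" using X(2) by fastforce
  define S P where "S = {x \<in> X. (a, x) \<in> parcs G}" and "P = {x \<in> X. (x, a) \<in> parcs G}"
  have "X \<subseteq> insert a (S \<union> P)" using total[OF a] by (auto simp: S_def P_def)
  then have "card X \<le> card (insert a (S \<union> P))"
    using fin by (intro card_mono) (auto simp: S_def P_def)
  also have "\<dots> \<le> Suc (card S + card P)"
    by (rule order_trans[OF card_insert_le_m1[of "Suc (card S + card P)"]])
      (simp_all add: card_Un_le)
  finally consider "card S \<ge> 2" | "card P \<ge> 2" using X(2) by linarith
  then show thesis
  proof cases
    \<comment> \<open>Here \<open>a\<close> is the source of the triangle, in the other case its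
      sink; the arc between \<open>x\<close> and \<open>y\<close> may point either way.\<close>
    case 1
    then obtain x y where "x \<in> S" "y \<in> S" "x \<noteq> y"
      by (auto simp: card_le_Suc_iff numeral_2_eq_2)
    then show thesis using total[of x y] that[OF a] by (auto simp: S_def)
  next
    case 2
    then obtain x y where "x \<in> P" "y \<in> P" "x \<noteq> y"
      by (auto simp: card_le_Suc_iff numeral_2_eq_2)
    then show thesis using total[of x y] that[OF _ _ a] by (auto simp: P_def)
  qed
qed

lemma turanable_dominated_bowtie: "turanable dominated_bowtie"
  unfolding turanable_def
proof (intro exI[of _ 9] allI impI)
  fix G :: "nat pair_pre_digraph"
  assume "regular_tournament G \<and> 9 \<le> card (pverts G)"
  then have reg: "regular_tournament G" and n: "9 \<le> card (pverts G)" by auto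
  interpret tournament G using reg by (simp add: regular_tournament_def)
  have loop: "(v, v) \<notin> parcs G" for v using pair_no_loops by fastforce
  have asym: "(y, x) \<notin> parcs G" if "(x, y) \<in> parcs G" for x y
    using not_both_directions[OF in_arcsD1[OF that] in_arcsD2[OF that]] that loop by blast
  obtain a where a: "a \<in> pverts G" using n by fastforce
  \<comment> \<open>The threshold 9 comes from here: (9 - 1) / 2 = 4 out-neighbours force a
    transitive triangle among them.\<close>
  have "card {x. (a, x) \<in> parcs G} \<ge> 4"
    using regular_tournament_min_degree(1)[OF reg a] n by linarith
  moreover have "{x. (a, x) \<in> parcs G} \<subseteq> pverts G" using in_arcsD2 by blast
  ultimately obtain b c d where bcd: "(a, b) \<in> parcs G" "(a, c) \<in> parcs G" "(a, d) \<in> parcs G"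
    "(b, c) \<in> parcs G" "(c, d) \<in> parcs G" "(b, d) \<in> parcs G"
    using tournament_transitive_triangle[OF tournament_axioms] by blast
  obtain e where e: "(c, e) \<in> parcs G" "(e, b) \<in> parcs G"
    using regular_tournament_arc_in_cyclic_triangle[OF reg bcd(4)] .
  obtain f where f: "(d, f) \<in> parcs G" "(f, c) \<in> parcs G"
    using regular_tournament_arc_in_cyclic_triangle[OF reg bcd(5)] .
  \<comment> \<open>Any coincidence would create a loop or a pair of opposite arcs. The arc from
    \<open>b\<close> to \<open>d\<close>, absent from the witness, excludes \<open>e = d\<close> and
    \<open>f = b\<close>.\<close>
  have "distinct [a, b, c, d, e, f]"
    using bcd e f loop by (auto dest: asym)
  then show "contains_copy G dominated_bowtie"
    by (rule contains_copy_dominated_bowtieI[OF pair_wf_digraph]) (use bcd e f in simp)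
qed

theorem theorem1p6:
  shows "\<exists>H :: nat pair_pre_digraph.
    oriented_graph H \<and> turanable H \<and> (\<forall>s\<ge>1. \<not> contains_copy (D_tournament s) H)"
  using oriented_graph_dominated_bowtie turanable_dominated_bowtie
    not_contains_copy_D_tournament_dominated_bowtie by blast

end
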